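(* For every $x \in (0, \pi/2)$, the double inequality $$\frac{2 + \cos x}{3} - \left(\frac{2}{3} - \frac{2}{\pi}\right)\Phi_1(x) < \frac{\sin x}{x} < \frac{2 + \cos x}{3} - \left(\frac{2}{3} - \frac{2}{\pi}\right)\Phi_2(x)$$ holds, where $\Phi_1(x) := (\pi/2-1)^{-1}(x-\sin x)$ and $\Phi_2(x) := (\pi/2-1)^{-2}(x-\sin x)^2$.
   Context: All functions are real-valued functions of a real variable. *)

theory Defs
  imports Complex_Main
begin

definition Phi1 :: "real \<Rightarrow> real" where
  "Phi1 x = inverse (pi / 2 - 1) * (x - sin x)"

definition Phi2 :: "real \<Rightarrow> real" where
  "Phi2 x = inverse ((pi / 2 - 1) ^ 2) * (x - sin x) ^ 2"

end

theory Submission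
  imports Defs
begin

text \<open>
  Write \<open>D x = (2 + cos x) / 3 - sin x / x\<close> and \<open>S x = x - sin x\<close>. At \<open>pi / 2\<close> these take the
  values \<open>2 / 3 - 2 / pi\<close> and \<open>pi / 2 - 1\<close>, so the two inequalities say precisely that
  \<open>D x / S x < D (pi / 2) / S (pi / 2)\<close> and \<open>(S x)\<^sup>2 / D x < (S (pi / 2))\<^sup>2 / D (pi / 2)\<close>.
  Hence it is enough that both \<open>D / S\<close> and \<open>S\<^sup>2 / D\<close> are strictly increasing on \<open>(0, pi / 2]\<close>
  (lemmas \<open>gap_over_excess_strict_mono\<close> and \<open>excess_square_over_gap_strict_mono\<close>).

  Both follow from the monotone form of l'Hospital's rule (\<open>monotone_lhospital\<close>): a quotient of two
  functions vanishing at the left endpoint inherits strict monotonicity from the quotient of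
  their derivatives. Three applications, cancelling common powers of \<open>x\<close> on the way, reduce
  \<open>D / S\<close> to \<open>x sin x / (3 sin x + x cos x)\<close>, which increases because \<open>sin\<close> increases while
  \<open>sin x / x\<close> and \<open>cos\<close> decrease. Three applications reduce \<open>S\<^sup>2 / D\<close> to a sum of elementary
  terms, each of which is monotone; the only delicate one is \<open>x cos x / sin x - 4 cos x\<close>, where
  the inequality \<open>x - sin x cos x < 4 (sin x)\<^sup>3\<close> is needed.
\<close>

section \<open>The monotone form of l'Hospital's rule\<close>

lemma strict_mono_on_left_open_if_deriv_pos:
  fixes f f' :: "real \<Rightarrow> real"
  assumes "\<And>t. t \<in> {a<..b} \<Longrightarrow> (f has_real_derivative f' t) (at t)"
    and "\<And>t. t \<in> {a<..b} \<Longrightarrow> f' t > 0"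
  shows "strict_mono_on {a<..b} f"
proof (rule strict_mono_onI)
  fix x y assume xy: "x \<in> {a<..b}" "y \<in> {a<..b}" "x < y"
  show "f x < f y"
    by (rule DERIV_pos_imp_increasing[OF xy(3)]) (use xy assms in fastforce)
qed

lemma pos_if_deriv_pos_and_tendsto_0:
  fixes f f' :: "real \<Rightarrow> real"
  assumes lim: "(f \<longlongrightarrow> 0) (at_right a)"
    and der: "\<And>t. t \<in> {a<..b} \<Longrightarrow> (f has_real_derivative f' t) (at t)"
    and pos: "\<And>t. t \<in> {a<..b} \<Longrightarrow> f' t > 0"
    and x: "x \<in> {a<..b}"
  shows "f x > 0"
proof -
  have mono: "strict_mono_on {a<..b} f"
    by (rule strict_mono_on_left_open_if_deriv_pos[OF der pos])
  define m where "m = (a + x) / 2"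
  have m: "a < m" "m < x" "m \<in> {a<..b}" using x by (auto simp: m_def)
  have "\<forall>\<^sub>F t in at_right a. f t \<le> f m"
    unfolding eventually_at_right_field
    using m strict_mono_onD[OF mono, of _ m]
    by (intro exI[of _ m]) (auto intro: less_imp_le)
  then have "0 \<le> f m"
    by (rule tendsto_upperbound[OF lim]) auto
  also have "f m < f x" using strict_mono_onD[OF mono m(3) x m(2)] .
  finally show ?thesis .
qed

text \<open>
  Let \<open>r\<close> be the derivative quotient at \<open>x\<close>. The function \<open>f - r * g\<close> decreases up to \<open>x\<close> and
  increases afterwards. The first fact gives \<open>f x < r * g x\<close>, the second
  \<open>f y - f x > r * (g y - g x)\<close>, and together they yield \<open>f x / g x < f y / g y\<close>. Only the limits
  at \<open>a\<close> enter, so the rule applies to functions such as \<open>sin x / x\<close> whose formula has no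
  meaning at \<open>a\<close> itself.
\<close>

lemma monotone_lhospital:
  fixes f g f' g' :: "real \<Rightarrow> real"
  assumes limf: "(f \<longlongrightarrow> 0) (at_right a)" and limg: "(g \<longlongrightarrow> 0) (at_right a)"
    and derf: "\<And>t. t \<in> {a<..b} \<Longrightarrow> (f has_real_derivative f' t) (at t)"
    and derg: "\<And>t. t \<in> {a<..b} \<Longrightarrow> (g has_real_derivative g' t) (at t)"
    and posg': "\<And>t. t \<in> {a<..b} \<Longrightarrow> g' t > 0"
    and mono: "strict_mono_on {a<..b} (\<lambda>t. f' t / g' t)"
  shows "strict_mono_on {a<..b} (\<lambda>t. f t / g t)"
proof (rule strict_mono_onI)
  fix x y assume x: "x \<in> {a<..b}" and y: "y \<in> {a<..b}" and xy: "x < y"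
  have gpos: "g t > 0" if "t \<in> {a<..b}" for t
    by (rule pos_if_deriv_pos_and_tendsto_0[OF limg derg posg' that])
  have glt: "g x < g y"
    using strict_mono_onD[OF strict_mono_on_left_open_if_deriv_pos[OF derg posg'] x y xy] .
  define r where "r = f' x / g' x"
  have left: "f' t < r * g' t" if "t \<in> {a<..b}" "t < x" for t
    using strict_mono_onD[OF mono that(1) x that(2)] posg'[OF that(1)]
    by (simp add: r_def[symmetric] pos_divide_less_eq)
  have right: "f' t > r * g' t" if "t \<in> {a<..b}" "t > x" for t
    using strict_mono_onD[OF mono x that(1) that(2)] posg'[OF that(1)]
    by (simp add: r_def[symmetric] pos_less_divide_eq)
  define h where "h = (\<lambda>t. r * g t - f t)"
  have derh: "(h has_real_derivative r * g' t - f' t) (at t)" if "t \<in> {a<..b}" for t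
    unfolding h_def by (intro DERIV_diff DERIV_cmult derf derg that)
  have limh: "(h \<longlongrightarrow> 0) (at_right a)"
    unfolding h_def by (rule tendsto_eq_intros limf limg refl | simp)+
  \<comment> \<open>The derivative of \<open>h\<close> vanishes at \<open>x\<close>, so positivity is first obtained at points before
     \<open>x\<close> and then carried to \<open>x\<close> by the mean value theorem.\<close>
  define m where "m = (a + x) / 2"
  have m: "a < m" "m < x" "m \<in> {a<..m}" using x by (auto simp: m_def)
  have "h m > 0"
    by (rule pos_if_deriv_pos_and_tendsto_0[OF limh derh _ m(3)])
      (use m x left in auto)
  also have "h m < h x"
  proof -
    obtain z where z: "m < z" "z < x" "h x - h m = (x - m) * (r * g' z - f' z)"
      using MVT2[OF m(2), of h "\<lambda>t. r * g' t - f' t"] derh m x by force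
    have "r * g' z - f' z > 0" using left[of z] z m x by simp
    with z(3) m(2) show ?thesis by (metis diff_gt_0_iff_gt mult_pos_pos)
  qed
  finally have fx: "f x < r * g x" by (simp add: h_def)
  have fy: "f y - f x > r * (g y - g x)"
  proof -
    obtain z where z: "x < z" "z < y" "h y - h x = (y - x) * (r * g' z - f' z)"
      using MVT2[OF xy, of h "\<lambda>t. r * g' t - f' t"] derh x y by force
    have "r * g' z - f' z < 0" using right[of z] z x y by simp
    with xy have "h y - h x < 0" unfolding z(3) by (simp add: mult_pos_neg)
    then show ?thesis by (simp add: h_def algebra_simps)
  qed
  have "f x / g x < r" using fx gpos[OF x] by (simp add: pos_divide_less_eq)
  then have "f x / g x * (g y - g x) < r * (g y - g x)"
    using glt by (intro mult_strict_right_mono) auto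
  moreover have "f x / g x * (g y - g x) = f x / g x * g y - f x"
    using gpos[OF x] by (simp add: right_diff_distrib)
  ultimately have "f x / g x * g y < f y"
    using fy by linarith
  then show "f x / g x < f y / g y"
    using gpos[OF y] by (simp add: pos_less_divide_eq)
qed

section \<open>Elementary trigonometric facts\<close>

lemma sin_pos_if: "x \<in> {0<..pi / 2} \<Longrightarrow> sin x > 0"
  by (auto intro!: sin_gt_zero)

lemma cos_nonneg_if: "x \<in> {0<..pi / 2} \<Longrightarrow> cos x \<ge> 0"
  by (auto intro!: cos_ge_zero)

lemma cos_less_1_if: "x \<in> {0<..pi / 2} \<Longrightarrow> cos x < 1"
  using cos_monotone_0_pi[of 0 x] by simp

lemma cos_strict_antimono: "strict_mono_on {0<..pi / 2} (\<lambda>x. - cos x :: real)"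
  by (rule strict_mono_onI) (auto intro!: cos_monotone_0_pi)

lemma sin_strict_mono: "strict_mono_on {0<..pi / 2} (sin :: real \<Rightarrow> real)"
  by (rule strict_mono_onI) (auto intro!: sin_monotone_2pi)

lemma sinc_strict_antimono: "strict_mono_on {0<..pi / 2} (\<lambda>x :: real. - sin x / x)"
proof (rule monotone_lhospital[where f' = "\<lambda>x. - cos x" and g' = "\<lambda>x. 1"])
  show "strict_mono_on {0<..pi / 2} (\<lambda>t :: real. - cos t / 1)"
    using cos_strict_antimono by simp
qed (auto intro!: derivative_eq_intros tendsto_eq_intros)

lemma sin_ge_half:
  assumes "x \<in> {0<..pi / 2}"
  shows "x / 2 \<le> sin x"
proof -
  have "sin x / x \<ge> sin (pi / 2) / (pi / 2)"
  proof (cases "x = pi / 2")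
    case False
    then show ?thesis
      using strict_mono_onD[OF sinc_strict_antimono assms, of "pi / 2"] assms by auto
  qed (simp only: order_refl)
  moreover have "sin (pi / 2) / (pi / 2) \<ge> 1 / 2"
    using pi_less_4 by (simp add: field_simps)
  ultimately have "1 / 2 \<le> sin x / x" by linarith
  then show ?thesis using assms by (simp add: field_simps)
qed

lemma one_minus_cos_le_sin_square:
  assumes "x \<in> {0<..pi / 2}"
  shows "1 - cos x \<le> (sin x)\<^sup>2"
proof -
  have "(cos x)\<^sup>2 \<le> cos x"
    using cos_nonneg_if[OF assms] by (simp add: power2_eq_square mult_left_le)
  then show ?thesis by (simp add: sin_squared_eq)
qed

text \<open>
  Split the left-hand side as \<open>(x - sin x) + sin x (1 - cos x)\<close>. The second summand is at most
  \<open>(sin x)\<^sup>3\<close>. The first is less than \<open>3 x\<^sup>3 / 8\<close>, as comparing derivatives shows, and this is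
  at most \<open>3 (sin x)\<^sup>3\<close> because \<open>sin x \<ge> x / 2\<close>.
\<close>

lemma minus_sin_cos_less_sin_cube:
  assumes x: "x \<in> {0<..pi / 2}"
  shows "x - sin x * cos x < 4 * sin x ^ 3"
proof -
  have "3 / 8 * x ^ 3 - (x - sin x) > 0"
  proof (rule pos_if_deriv_pos_and_tendsto_0[OF _ _ _ x,
        where f' = "\<lambda>t. 9 / 8 * t\<^sup>2 - (1 - cos t)"])
    fix t :: real assume t: "t \<in> {0<..pi / 2}"
    have "(sin t)\<^sup>2 \<le> t\<^sup>2"
      using sin_x_le_x[of t] sin_pos_if[OF t] t by (intro power_mono) auto
    then have "1 - cos t \<le> t\<^sup>2" using one_minus_cos_le_sin_square[OF t] by linarith
    moreover have "t\<^sup>2 > 0" using t by simp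
    ultimately show "9 / 8 * t\<^sup>2 - (1 - cos t) > 0" by linarith
  qed (auto intro!: derivative_eq_intros tendsto_eq_intros)
  moreover have "(x / 2) ^ 3 \<le> sin x ^ 3"
    using sin_ge_half[OF x] x by (intro power_mono) auto
  moreover have "sin x * (1 - cos x) \<le> sin x * (sin x)\<^sup>2"
    using one_minus_cos_le_sin_square[OF x] sin_pos_if[OF x] by (intro mult_left_mono) auto
  ultimately show ?thesis
    by (simp add: algebra_simps power2_eq_square power3_eq_cube)
qed

section \<open>The gap and its derivatives\<close>

definition cusa_gap :: "real \<Rightarrow> real" where
  "cusa_gap x = (2 + cos x) / 3 - sin x / x"

text \<open>The numerator of the derivative of the gap over the denominator \<open>3 * x\<^sup>2\<close>.\<close>

definition gap_num :: "real \<Rightarrow> real" where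
  "gap_num x = 3 * sin x - 3 * x * cos x - x\<^sup>2 * sin x"

lemma cusa_gap_tendsto_0: "(cusa_gap \<longlongrightarrow> 0) (at_right 0)"
proof -
  have "((\<lambda>x :: real. sin x / x) \<longlongrightarrow> 1) (at 0)"
    using DERIV_sin[of "0 :: real"] by (simp add: DERIV_def)
  then have "((\<lambda>x :: real. sin x / x) \<longlongrightarrow> 1) (at_right 0)"
    by (rule filterlim_mono[OF _ order_refl at_le]) simp
  moreover have "((\<lambda>x :: real. (2 + cos x) / 3) \<longlongrightarrow> 1) (at_right 0)"
    by (auto intro!: tendsto_eq_intros)
  ultimately have "((\<lambda>x :: real. (2 + cos x) / 3 - sin x / x) \<longlongrightarrow> 1 - 1) (at_right 0)"
    by (intro tendsto_diff)
  then show ?thesis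
    by (simp add: cusa_gap_def[abs_def])
qed

lemma cusa_gap_deriv:
  assumes "x \<noteq> 0"
  shows "(cusa_gap has_real_derivative gap_num x / (3 * x\<^sup>2)) (at x)"
  unfolding cusa_gap_def gap_num_def
  by (rule derivative_eq_intros refl | use assms in \<open>simp add: field_simps power2_eq_square\<close>)+

lemma gap_num_deriv:
  "(gap_num has_real_derivative x * (sin x - x * cos x)) (at x)"
  unfolding gap_num_def
  by (rule derivative_eq_intros refl | simp add: algebra_simps power2_eq_square)+

lemma gap_num_tendsto_0: "(gap_num \<longlongrightarrow> 0) (at_right 0)"
  unfolding gap_num_def by (auto intro!: tendsto_eq_intros)

lemma sin_minus_x_cos_deriv:
  "((\<lambda>x. sin x - x * cos x) has_real_derivative x * sin x) (at x)"
  by (auto intro!: derivative_eq_intros)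

lemma sin_minus_x_cos_tendsto_0:
  "((\<lambda>x :: real. sin x - x * cos x) \<longlongrightarrow> 0) (at_right 0)"
  by (auto intro!: tendsto_eq_intros)

lemma sin_minus_x_cos_pos:
  assumes "x \<in> {0<..pi / 2}"
  shows "sin x - x * cos x > 0"
  by (rule pos_if_deriv_pos_and_tendsto_0[OF sin_minus_x_cos_tendsto_0 sin_minus_x_cos_deriv _ assms])
    (auto simp: sin_pos_if)

lemma gap_num_pos:
  assumes "x \<in> {0<..pi / 2}"
  shows "gap_num x > 0"
  by (rule pos_if_deriv_pos_and_tendsto_0[OF gap_num_tendsto_0 gap_num_deriv _ assms])
    (use sin_minus_x_cos_pos in auto)

lemma cusa_gap_pos:
  assumes "x \<in> {0<..pi / 2}"
  shows "cusa_gap x > 0"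
  by (rule pos_if_deriv_pos_and_tendsto_0[OF cusa_gap_tendsto_0 cusa_gap_deriv _ assms])
    (use gap_num_pos in auto)

lemma x_minus_sin_pos:
  assumes "x \<in> {0<..pi / 2}"
  shows "x - sin x > 0"
  by (rule pos_if_deriv_pos_and_tendsto_0[OF _ _ _ assms, where f' = "\<lambda>x. 1 - cos x"])
    (auto intro!: derivative_eq_intros tendsto_eq_intros simp: cos_less_1_if)

section \<open>The lower bound\<close>

lemma gap_over_excess_strict_mono:
  "strict_mono_on {0<..pi / 2} (\<lambda>x. cusa_gap x / (x - sin x))"
proof -
  have r3: "strict_mono_on {0<..pi / 2} (\<lambda>x :: real. (x * sin x) / (3 * sin x + x * cos x))"
  proof (rule strict_mono_onI)
    fix x y :: real
    assume x: "x \<in> {0<..pi / 2}" and y: "y \<in> {0<..pi / 2}" and xy: "x < y"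
    \<comment> \<open>Dividing through by the variable separates the increasing numerator from a decreasing
       denominator.\<close>
    have eq: "(t * sin t) / (3 * sin t + t * cos t) = sin t / (3 * (sin t / t) + cos t)"
      if "t \<in> {0<..pi / 2}" for t :: real
    proof -
      have "3 * sin t + t * cos t = t * (3 * (sin t / t) + cos t)"
        using that by (simp add: algebra_simps)
      then show ?thesis using that by simp
    qed
    have "sin x / (3 * (sin x / x) + cos x) < sin y / (3 * (sin y / y) + cos y)"
    proof (rule frac_less)
      show "0 \<le> sin x" using sin_pos_if[OF x] by simp
      show "sin x < sin y" using strict_mono_onD[OF sin_strict_mono x y xy] .
      have "sin y / y > 0" using sin_pos_if[OF y] y by simp
      then show "0 < 3 * (sin y / y) + cos y" using cos_nonneg_if[OF y] by linarith
      have "sin y / y < sin x / x"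
        using strict_mono_onD[OF sinc_strict_antimono x y xy] by simp
      moreover have "cos y < cos x"
        using strict_mono_onD[OF cos_strict_antimono x y xy] by simp
      ultimately show "3 * (sin y / y) + cos y \<le> 3 * (sin x / x) + cos x" by linarith
    qed
    then show "(x * sin x) / (3 * sin x + x * cos x) < (y * sin y) / (3 * sin y + y * cos y)"
      by (simp only: eq[OF x] eq[OF y])
  qed
  have pos2: "2 * (1 - cos x) + x * sin x > 0" if "x \<in> {0<..pi / 2}" for x :: real
    using cos_less_1_if[OF that] sin_pos_if[OF that] that by (intro add_pos_pos) auto
  have r2: "strict_mono_on {0<..pi / 2}
      (\<lambda>x :: real. (sin x - x * cos x) / (2 * (1 - cos x) + x * sin x))"
  proof (rule monotone_lhospital[OF sin_minus_x_cos_tendsto_0 _ sin_minus_x_cos_deriv _ _ r3])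
    fix t :: real assume t: "t \<in> {0<..pi / 2}"
    show "3 * sin t + t * cos t > 0"
      using sin_pos_if[OF t] cos_nonneg_if[OF t] t by (intro add_pos_nonneg) auto
  qed (auto intro!: derivative_eq_intros tendsto_eq_intros)
  have r1: "strict_mono_on {0<..pi / 2} (\<lambda>x. gap_num x / (3 * (x\<^sup>2 * (1 - cos x))))"
  proof (rule monotone_lhospital[OF gap_num_tendsto_0 _ gap_num_deriv,
        where g' = "\<lambda>x. 3 * (x * (2 * (1 - cos x) + x * sin x))"])
    show "strict_mono_on {0<..pi / 2} (\<lambda>t :: real. t * (sin t - t * cos t) /
       (3 * (t * (2 * (1 - cos t) + t * sin t))))"
    proof (rule strict_mono_onI)
      fix x y :: real
      assume x: "x \<in> {0<..pi / 2}" and y: "y \<in> {0<..pi / 2}" and xy: "x < y"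
      have eq: "t * (sin t - t * cos t) / (3 * (t * (2 * (1 - cos t) + t * sin t)))
          = (sin t - t * cos t) / (2 * (1 - cos t) + t * sin t) / 3"
        if "t \<in> {0<..pi / 2}" for t :: real using that by simp
      show "x * (sin x - x * cos x) / (3 * (x * (2 * (1 - cos x) + x * sin x)))
          < y * (sin y - y * cos y) / (3 * (y * (2 * (1 - cos y) + y * sin y)))"
        unfolding eq[OF x] eq[OF y]
        using strict_mono_onD[OF r2 x y xy] by (intro divide_strict_right_mono) auto
    qed
  next
    fix t :: real assume "t \<in> {0<..pi / 2}"
    then show "3 * (t * (2 * (1 - cos t) + t * sin t)) > 0" using pos2 by simp
  next
    fix t :: real
    show "((\<lambda>x. 3 * (x\<^sup>2 * (1 - cos x))) has_real_derivative
        3 * (t * (2 * (1 - cos t) + t * sin t))) (at t)"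
      by (rule derivative_eq_intros refl | simp add: algebra_simps power2_eq_square)+
  qed (auto intro!: tendsto_eq_intros)
  show ?thesis
  proof (rule monotone_lhospital[OF cusa_gap_tendsto_0 _ cusa_gap_deriv,
        where g' = "\<lambda>x. 1 - cos x"])
    show "strict_mono_on {0<..pi / 2} (\<lambda>t. gap_num t / (3 * t\<^sup>2) / (1 - cos t))"
      using r1 by (simp add: mult.assoc)
  qed (auto intro!: derivative_eq_intros tendsto_eq_intros simp: cos_less_1_if)
qed

section \<open>The upper bound\<close>

lemma x_cot_minus_four_cos_strict_mono:
  "strict_mono_on {0<..pi / 2} (\<lambda>x :: real. x * cos x / sin x - 4 * cos x)"
proof (rule strict_mono_on_left_open_if_deriv_pos
    [where f' = "\<lambda>x. (4 * sin x ^ 3 - (x - sin x * cos x)) / (sin x)\<^sup>2"])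
  fix t :: real assume t: "t \<in> {0<..pi / 2}"
  show "(4 * sin t ^ 3 - (t - sin t * cos t)) / (sin t)\<^sup>2 > 0"
    using minus_sin_cos_less_sin_cube[OF t] sin_pos_if[OF t] by simp
  have "((cos t - t * sin t) * sin t - t * cos t * cos t) / (sin t * sin t) + 4 * sin t
      = (4 * sin t ^ 3 - (t - sin t * cos t)) / (sin t)\<^sup>2"
  proof -
    have "(cos t - t * sin t) * sin t - t * cos t * cos t
        = sin t * cos t - t * ((sin t)\<^sup>2 + (cos t)\<^sup>2)"
      by (simp only: power2_eq_square algebra_simps)
    also have "\<dots> = sin t * cos t - t" by simp
    finally show ?thesis
      using sin_pos_if[OF t] by (simp add: field_simps power2_eq_square power3_eq_cube)
  qed
  moreover have "((\<lambda>x. x * cos x / sin x - 4 * cos x) has_real_derivative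
      ((cos t - t * sin t) * sin t - t * cos t * cos t) / (sin t * sin t) + 4 * sin t) (at t)"
    using sin_pos_if[OF t] by (auto intro!: derivative_eq_intros)
  ultimately show "((\<lambda>x. x * cos x / sin x - 4 * cos x) has_real_derivative
      (4 * sin t ^ 3 - (t - sin t * cos t)) / (sin t)\<^sup>2) (at t)" by simp
qed

lemma tan_half_strict_mono:
  "strict_mono_on {0<..pi / 2} (\<lambda>x :: real. (1 - cos x) / sin x)"
proof (rule strict_mono_on_left_open_if_deriv_pos
    [where f' = "\<lambda>x. (1 - cos x) / (sin x)\<^sup>2"])
  fix t :: real assume t: "t \<in> {0<..pi / 2}"
  show "(1 - cos t) / (sin t)\<^sup>2 > 0"
    using cos_less_1_if[OF t] sin_pos_if[OF t] by simp
  have "sin t * sin t - (1 - cos t) * cos t = (sin t)\<^sup>2 + (cos t)\<^sup>2 - cos t"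
    by (simp only: power2_eq_square algebra_simps)
  then have "sin t * sin t - (1 - cos t) * cos t = 1 - cos t" by simp
  moreover have "((\<lambda>x. (1 - cos x) / sin x) has_real_derivative
      (sin t * sin t - (1 - cos t) * cos t) / (sin t * sin t)) (at t)"
    using sin_pos_if[OF t] by (auto intro!: derivative_eq_intros)
  ultimately show "((\<lambda>x. (1 - cos x) / sin x) has_real_derivative
      (1 - cos t) / (sin t)\<^sup>2) (at t)" by (simp add: power2_eq_square)
qed

lemma one_minus_cos_over_x_strict_mono:
  "strict_mono_on {0<..pi / 2} (\<lambda>x :: real. (1 - cos x) / x)"
proof (rule monotone_lhospital[where f' = sin and g' = "\<lambda>x. 1"])
  show "strict_mono_on {0<..pi / 2} (\<lambda>t :: real. sin t / 1)"
    using sin_strict_mono by simp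
qed (auto intro!: derivative_eq_intros tendsto_eq_intros)

lemma excess_square_over_gap_strict_mono:
  "strict_mono_on {0<..pi / 2} (\<lambda>x. (x - sin x)\<^sup>2 / cusa_gap x)"
proof -
  \<comment> \<open>Up to the factor 6, \<open>Q / gap_num\<close> is the quotient of the derivatives of \<open>(x - sin x)\<^sup>2\<close> and
     the gap. The derivatives of \<open>Q\<close> and \<open>gap_num\<close> share a factor \<open>x\<close>; \<open>q\<close> is what remains of the
     former once it is removed, and \<open>q'\<close> is the derivative of \<open>q\<close>.\<close>
  define q q' Q where
    "q = (\<lambda>x :: real. 2 * (1 - cos x) * (x - sin x) + x * sin x * (x - sin x) + x * (1 - cos x)\<^sup>2)"
    and "q' = (\<lambda>x :: real. 3 * sin x * (x - sin x) + 3 * (1 - cos x)\<^sup>2 + x * cos x * (x - sin x)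
      + 3 * x * sin x * (1 - cos x))"
    and "Q = (\<lambda>x :: real. x\<^sup>2 * (1 - cos x) * (x - sin x))"
  have r3: "strict_mono_on {0<..pi / 2} (\<lambda>x. q' x / (x * sin x))"
  proof (rule strict_mono_onI)
    fix x y :: real
    assume x: "x \<in> {0<..pi / 2}" and y: "y \<in> {0<..pi / 2}" and xy: "x < y"
    have eq: "q' t / (t * sin t) = 6 + 3 * (- sin t / t)
        + 3 * ((1 - cos t) / sin t * ((1 - cos t) / t)) + (t * cos t / sin t - 4 * cos t)"
      if "t \<in> {0<..pi / 2}" for t
      using sin_pos_if[OF that] that
      by (simp add: q'_def field_simps power2_eq_square)
    have "(1 - cos x) / sin x * ((1 - cos x) / x) < (1 - cos y) / sin y * ((1 - cos y) / y)"
      using strict_mono_onD[OF tan_half_strict_mono x y xy]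
        strict_mono_onD[OF one_minus_cos_over_x_strict_mono x y xy]
        cos_less_1_if[OF x] sin_pos_if[OF x] x
      by (intro mult_strict_mono') auto
    then show "q' x / (x * sin x) < q' y / (y * sin y)"
      unfolding eq[OF x] eq[OF y]
      using strict_mono_onD[OF sinc_strict_antimono x y xy]
        strict_mono_onD[OF x_cot_minus_four_cos_strict_mono x y xy]
      by linarith
  qed
  have r2: "strict_mono_on {0<..pi / 2} (\<lambda>x. q x / (sin x - x * cos x))"
  proof (rule monotone_lhospital[OF _ sin_minus_x_cos_tendsto_0 _ sin_minus_x_cos_deriv _ r3])
    show "(q \<longlongrightarrow> 0) (at_right 0)"
      unfolding q_def by (auto intro!: tendsto_eq_intros)
    show "(q has_real_derivative q' t) (at t)" for t
      unfolding q_def q'_def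
      by (rule derivative_eq_intros refl | simp add: algebra_simps power2_eq_square)+
  qed (auto simp: sin_pos_if)
  have r1: "strict_mono_on {0<..pi / 2} (\<lambda>x. Q x / gap_num x)"
  proof (rule monotone_lhospital[OF _ gap_num_tendsto_0 _ gap_num_deriv,
        where f' = "\<lambda>x. x * q x"])
    show "(Q \<longlongrightarrow> 0) (at_right 0)"
      unfolding Q_def by (auto intro!: tendsto_eq_intros)
    show "(Q has_real_derivative t * q t) (at t)" for t
      unfolding Q_def q_def
      by (rule derivative_eq_intros refl | simp add: algebra_simps power2_eq_square)+
    show "strict_mono_on {0<..pi / 2} (\<lambda>t. t * q t / (t * (sin t - t * cos t)))"
      by (rule strict_mono_onI) (use strict_mono_onD[OF r2] in auto)
  qed (use sin_minus_x_cos_pos in auto)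
  show ?thesis
  proof (rule monotone_lhospital[OF _ cusa_gap_tendsto_0 _ cusa_gap_deriv,
        where f' = "\<lambda>x. 2 * (x - sin x) * (1 - cos x)"])
    show "strict_mono_on {0<..pi / 2}
        (\<lambda>t. 2 * (t - sin t) * (1 - cos t) / (gap_num t / (3 * t\<^sup>2)))"
    proof (rule strict_mono_onI)
      fix x y :: real
      assume x: "x \<in> {0<..pi / 2}" and y: "y \<in> {0<..pi / 2}" and xy: "x < y"
      have eq: "2 * (t - sin t) * (1 - cos t) / (gap_num t / (3 * t\<^sup>2)) = 6 * (Q t / gap_num t)"
        for t by (simp add: Q_def)
      show "2 * (x - sin x) * (1 - cos x) / (gap_num x / (3 * x\<^sup>2))
          < 2 * (y - sin y) * (1 - cos y) / (gap_num y / (3 * y\<^sup>2))"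
        unfolding eq using strict_mono_onD[OF r1 x y xy] by simp
    qed
  qed (auto intro!: derivative_eq_intros tendsto_eq_intros simp: gap_num_pos)
qed

section \<open>The double inequality\<close>

theorem theorem1:
  fixes x :: real
  assumes "x \<in> {0<..<pi / 2}"
  shows "(2 + cos x) / 3 - (2 / 3 - 2 / pi) * Phi1 x < sin x / x
       \<and> sin x / x < (2 + cos x) / 3 - (2 / 3 - 2 / pi) * Phi2 x"
proof -
  define c k where "c = pi / 2 - 1" and "k = 2 / 3 - 2 / pi"
  have x: "x \<in> {0<..pi / 2}" and less: "x < pi / 2" and e: "pi / 2 \<in> {0<..pi / 2}"
    using assms by auto
  have gap_end: "cusa_gap (pi / 2) = k"
    by (simp add: cusa_gap_def k_def)
  have k: "k > 0" using cusa_gap_pos[OF e] gap_end by simp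
  have c: "c > 0" using x_minus_sin_pos[OF e] by (simp add: c_def)
  have "cusa_gap x / (x - sin x) < k / c"
    using strict_mono_onD[OF gap_over_excess_strict_mono x e less] gap_end
    by (simp add: c_def)
  then have lower: "cusa_gap x < k * (inverse c * (x - sin x))"
    using x_minus_sin_pos[OF x] c by (simp add: field_simps)
  have "(x - sin x)\<^sup>2 / cusa_gap x < c\<^sup>2 / k"
    using strict_mono_onD[OF excess_square_over_gap_strict_mono x e less] gap_end
    by (simp add: c_def)
  then have upper: "k * (inverse (c\<^sup>2) * (x - sin x)\<^sup>2) < cusa_gap x"
    using cusa_gap_pos[OF x] c k by (simp add: field_simps)
  show ?thesis
    using lower upper
    unfolding Phi1_def Phi2_def c_def[symmetric] k_def[symmetric] cusa_gap_def by linarith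
qed

end
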